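(* Let $\ell$ be a prime, and let $\omega=e^{2\pi i/3}$. For each $\beta\in\mathbb{Z}$ with $\beta<\frac{\sqrt3}{2}\ell$ which is primitively represented by an element of $\mathbb{Z}[\omega]$ (that is, $\beta=a^2-ab+b^2$ for some $a,b\in\mathbb{Z}$ with $\gcd(a,b)=1$), there is a $3$-and-$1$ form of index $\ell$ whose temperament $\tau$ satisfies $\tau^2=\beta$.
   Context: A lattice in $\mathbb{R}^2\cong\mathbb{C}$ is the $\mathbb{Z}$-span of an $\mathbb{R}$-basis; $\langle\,,\rangle$ is the standard dot product. Let $\ell$ be a prime, $L$ a lattice and $M\subset L$ a sublattice of index $\ell$. The pair $(L,M)$ is a tempered perfect lattice (or form) of index $\ell$ if, after rescaling $L$ and $M$ by a common positive scalar, there exist non-empty sets $S\subset L-M$ and $S'\subset M-\{0\}$ such that, with $A(v)=\langle v,v\rangle$: (i) $A(v)=1$ for all $v\in S$; (ii) $A(v)>1$ for all $v\in L-M$ with $v\notin S$; (iii) $A(v)$ has a common value $u\geqslant 1$ for all $v\in S'$; (iv) $A(v)>u$ for all $v\in M-\{0\}$ with $v\notin S'$; (v) if $B$ is any positive definite quadratic form on $\mathbb{R}^2$ satisfying (i)--(iv) in place of $A$ with the same $S,S'$ and with common value $u'$ on $S'$, then $B=A$ and $u'=u$. The temperament is $\tau=\sqrt u$. It is called an $s$-and-$s'$ form if $S$ consists of $s$ pairs $\pm v$ and $S'$ consists of $s'$ pairs $\pm v$.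
   Formalization: The value β = 1 is excluded: although 1 is primitively represented, no 3-and-1 form has τ² = 1, since S and S' would give four pairs of minimal vectors of a plane lattice, which has at most three. *)

theory Defs
  imports "HOL-Analysis.Analysis" "HOL-Computational_Algebra.Primes"
begin

text \<open>
  The plane is the type \<^typ>\<open>complex\<close>, whose inner product \<open>\<bullet>\<close> is the standard dot product
  under \<open>x + iy \<mapsto> (x, y)\<close>.
\<close>

definition is_lattice :: "complex set \<Rightarrow> bool" where
  "is_lattice L \<longleftrightarrow>
     (\<exists>B. independent B \<and> span B = UNIV \<and>
          L = {\<Sum>b\<in>B. of_int (k b) *\<^sub>R b | k :: complex \<Rightarrow> int. True})"

definition lattice_index :: "complex set \<Rightarrow> complex set \<Rightarrow> nat" where
  "lattice_index L M = card ((\<lambda>v. (+) v ` M) ` L)"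

definition std_form :: "complex \<Rightarrow> real" where
  "std_form v = v \<bullet> v"

definition pos_def_quadratic_form :: "(complex \<Rightarrow> real) \<Rightarrow> bool" where
  "pos_def_quadratic_form Q \<longleftrightarrow>
     (\<exists>b :: complex \<Rightarrow> complex \<Rightarrow> real.
        bilinear b \<and> (\<forall>x y. b x y = b y x) \<and> (\<forall>v. Q v = b v v)) \<and>
     (\<forall>v. v \<noteq> 0 \<longrightarrow> Q v > 0)"

definition tempered_min ::
  "(complex \<Rightarrow> real) \<Rightarrow> real \<Rightarrow> complex set \<Rightarrow> complex set \<Rightarrow> complex set \<Rightarrow> complex set \<Rightarrow> bool" where
  "tempered_min Q u L M S S' \<longleftrightarrow>
     (\<forall>v\<in>S. Q v = 1) \<and>
     (\<forall>v\<in>L - M. v \<notin> S \<longrightarrow> Q v > 1) \<and>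
     u \<ge> 1 \<and> (\<forall>v\<in>S'. Q v = u) \<and>
     (\<forall>v\<in>M - {0}. v \<notin> S' \<longrightarrow> Q v > u)"

definition normalized_tempered_perfect ::
  "complex set \<Rightarrow> complex set \<Rightarrow> complex set \<Rightarrow> complex set \<Rightarrow> real \<Rightarrow> bool" where
  "normalized_tempered_perfect L M S S' u \<longleftrightarrow>
     S \<noteq> {} \<and> S \<subseteq> L - M \<and> S' \<noteq> {} \<and> S' \<subseteq> M - {0} \<and>
     tempered_min std_form u L M S S' \<and>
     (\<forall>B u'. pos_def_quadratic_form B \<longrightarrow> tempered_min B u' L M S S' \<longrightarrow>
        B = std_form \<and> u' = u)"

text \<open>
  In the next definition \<open>c\<close> is the common rescaling factor, and \<open>S\<close>, \<open>S'\<close>, \<open>u\<close> refer to the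
  rescaled pair.
\<close>

definition tempered_perfect_witness ::
  "nat \<Rightarrow> complex set \<Rightarrow> complex set \<Rightarrow> real \<Rightarrow> complex set \<Rightarrow> complex set \<Rightarrow> real \<Rightarrow> bool" where
  "tempered_perfect_witness l L M c S S' u \<longleftrightarrow>
     prime l \<and> is_lattice L \<and> is_lattice M \<and> M \<subseteq> L \<and> lattice_index L M = l \<and> c > 0 \<and>
     normalized_tempered_perfect ((*\<^sub>R) c ` L) ((*\<^sub>R) c ` M) S S' u"

definition tempered_perfect_form :: "nat \<Rightarrow> complex set \<Rightarrow> complex set \<Rightarrow> bool" where
  "tempered_perfect_form l L M \<longleftrightarrow> (\<exists>c S S' u. tempered_perfect_witness l L M c S S' u)"

definition temperament :: "nat \<Rightarrow> complex set \<Rightarrow> complex set \<Rightarrow> real" where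
  "temperament l L M =
     (THE \<tau>. \<exists>c S S' u. tempered_perfect_witness l L M c S S' u \<and> \<tau> = sqrt u)"

definition consists_of_pairs :: "nat \<Rightarrow> complex set \<Rightarrow> bool" where
  "consists_of_pairs s S \<longleftrightarrow>
     (\<exists>P. finite P \<and> card P = s \<and> S = P \<union> uminus ` P \<and> P \<inter> uminus ` P = {})"

definition s_and_s'_form :: "nat \<Rightarrow> nat \<Rightarrow> nat \<Rightarrow> complex set \<Rightarrow> complex set \<Rightarrow> bool" where
  "s_and_s'_form s s' l L M \<longleftrightarrow>
     (\<exists>c S S' u. tempered_perfect_witness l L M c S S' u \<and>
        consists_of_pairs s S \<and> consists_of_pairs s' S')"

text \<open>The scaling factor and \<open>u\<close> are determined by the pair, so \<^const>\<open>temperament\<close> is well defined.\<close>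

lemma tempered_perfect_witnessD:
  assumes "tempered_perfect_witness l L M c S S' u"
  shows "c > 0" "is_lattice L" "(*\<^sub>R) c ` M \<subseteq> (*\<^sub>R) c ` L" "u \<ge> 1"
    and "S \<subseteq> (*\<^sub>R) c ` L - (*\<^sub>R) c ` M" "S' \<subseteq> (*\<^sub>R) c ` M - {0}"
    and "S \<noteq> {}" "S' \<noteq> {}"
    and "\<And>v. v \<in> S \<Longrightarrow> v \<bullet> v = 1" "\<And>v. v \<in> S' \<Longrightarrow> v \<bullet> v = u"
    and "\<And>v. v \<in> (*\<^sub>R) c ` L \<Longrightarrow> v \<notin> (*\<^sub>R) c ` M \<Longrightarrow> v \<bullet> v \<ge> 1"
    and "\<And>v. v \<in> (*\<^sub>R) c ` M \<Longrightarrow> v \<noteq> 0 \<Longrightarrow> v \<bullet> v \<ge> u"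
proof -
  have w: "c > 0" "is_lattice L" "M \<subseteq> L"
    "normalized_tempered_perfect ((*\<^sub>R) c ` L) ((*\<^sub>R) c ` M) S S' u"
    using assms unfolding tempered_perfect_witness_def by simp_all
  then show "c > 0" "is_lattice L" "(*\<^sub>R) c ` M \<subseteq> (*\<^sub>R) c ` L"
    by (simp_all add: image_mono)
  have n: "S \<noteq> {}" "S \<subseteq> (*\<^sub>R) c ` L - (*\<^sub>R) c ` M" "S' \<noteq> {}" "S' \<subseteq> (*\<^sub>R) c ` M - {0}"
    "tempered_min std_form u ((*\<^sub>R) c ` L) ((*\<^sub>R) c ` M) S S'"
    using w(4) unfolding normalized_tempered_perfect_def by simp_all
  then show "S \<noteq> {}" "S \<subseteq> (*\<^sub>R) c ` L - (*\<^sub>R) c ` M" "S' \<noteq> {}" "S' \<subseteq> (*\<^sub>R) c ` M - {0}"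
    by simp_all
  have t: "\<forall>v\<in>S. v \<bullet> v = 1" "\<forall>v\<in>(*\<^sub>R) c ` L - (*\<^sub>R) c ` M. v \<notin> S \<longrightarrow> v \<bullet> v > 1"
    "u \<ge> 1" "\<forall>v\<in>S'. v \<bullet> v = u" "\<forall>v\<in>(*\<^sub>R) c ` M - {0}. v \<notin> S' \<longrightarrow> v \<bullet> v > u"
    using n(5) unfolding tempered_min_def std_form_def by simp_all
  show "u \<ge> 1" by (fact t(3))
  show "v \<bullet> v = 1" if "v \<in> S" for v using t(1) that by blast
  show "v \<bullet> v = u" if "v \<in> S'" for v using t(4) that by blast
  show "v \<bullet> v \<ge> 1" if "v \<in> (*\<^sub>R) c ` L" "v \<notin> (*\<^sub>R) c ` M" for v
    using t(1,2) that by (cases "v \<in> S") (auto intro: less_imp_le)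
  show "v \<bullet> v \<ge> u" if "v \<in> (*\<^sub>R) c ` M" "v \<noteq> 0" for v
    using t(4,5) that by (cases "v \<in> S'") (auto intro: less_imp_le)
qed

lemma tempered_perfect_scale_le:
  assumes 1: "tempered_perfect_witness l L M c S S' u"
    and 2: "tempered_perfect_witness l L M d T T' w"
  shows "c \<le> d"
proof -
  note c = tempered_perfect_witnessD[OF 1] and d = tempered_perfect_witnessD[OF 2]
  obtain t where t: "t \<in> S" using c(7) by blast
  then obtain v where v: "v \<in> L" "v \<notin> M" "t = c *\<^sub>R v" using c(5) by auto
  have "(c *\<^sub>R v) \<bullet> (c *\<^sub>R v) = 1" using c(9)[OF t] v(3) by simp
  then have eq: "c\<^sup>2 * (v \<bullet> v) = 1"
    by (simp only: inner_scaleR_left inner_scaleR_right power2_eq_square mult.assoc)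
  have "d *\<^sub>R v \<notin> (*\<^sub>R) d ` M" using v(2) d(1) by auto
  with d(11)[OF imageI[OF v(1)]] have "(d *\<^sub>R v) \<bullet> (d *\<^sub>R v) \<ge> 1" .
  then have "c\<^sup>2 * (v \<bullet> v) \<le> d\<^sup>2 * (v \<bullet> v)"
    unfolding eq by (simp only: inner_scaleR_left inner_scaleR_right power2_eq_square mult.assoc)
  moreover have "v \<noteq> 0" using eq by fastforce
  then have "v \<bullet> v > 0" by simp
  ultimately have "c\<^sup>2 \<le> d\<^sup>2" by (rule mult_right_le_imp_le)
  then show ?thesis using less_imp_le[OF d(1)] by (rule power2_le_imp_le)
qed

lemma tempered_perfect_u_le:
  assumes 1: "tempered_perfect_witness l L M c S S' u"
    and 2: "tempered_perfect_witness l L M c T T' w"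
  shows "u \<le> w"
proof -
  note c = tempered_perfect_witnessD[OF 1] and d = tempered_perfect_witnessD[OF 2]
  obtain v where v: "v \<in> T'" using d(8) by blast
  then have "v \<in> (*\<^sub>R) c ` M" "v \<noteq> 0" using d(6) by blast+
  from c(12)[OF this] show ?thesis using d(10)[OF v] by simp
qed

lemma tempered_perfect_witness_unique:
  assumes 1: "tempered_perfect_witness l L M c S S' u"
    and 2: "tempered_perfect_witness l L M d T T' w"
  shows "c = d" "u = w"
proof -
  show cd: "c = d"
    using tempered_perfect_scale_le[OF 1 2] tempered_perfect_scale_le[OF 2 1] by simp
  show "u = w"
    using tempered_perfect_u_le[OF 1 2[folded cd]] tempered_perfect_u_le[OF 2[folded cd] 1] by simp
qed

lemma temperament_eq:
  assumes "tempered_perfect_witness l L M c S S' u"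
  shows "temperament l L M = sqrt u"
  unfolding temperament_def
proof (rule the_equality)
  show "\<exists>c S S' v. tempered_perfect_witness l L M c S S' v \<and> sqrt u = sqrt v"
    by (rule exI[of _ c], rule exI[of _ S], rule exI[of _ S'], rule exI[of _ u]) (simp add: assms)
next
  fix \<tau>
  assume "\<exists>c S S' u. tempered_perfect_witness l L M c S S' u \<and> \<tau> = sqrt u"
  then obtain d T T' w where "tempered_perfect_witness l L M d T T' w" and w: "\<tau> = sqrt w"
    by (elim exE conjE)
  from tempered_perfect_witness_unique(2)[OF assms this(1)] w show "\<tau> = sqrt u" by simp
qed

text \<open>
  No 3-and-1 form has \<open>u = 1\<close>: the four pairs of vectors in \<open>S \<union> S'\<close> would be minimal vectors of one
  plane lattice. Hence the value \<open>\<beta> = 1\<close>, although primitively represented, is not attained.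
\<close>

lemma lattice_diff:
  assumes "is_lattice L" "x \<in> L" "y \<in> L"
  shows "x - y \<in> L"
proof -
  obtain B where L: "L = {\<Sum>b\<in>B. of_int (k b) *\<^sub>R b | k :: complex \<Rightarrow> int. True}"
    using assms(1) unfolding is_lattice_def by blast
  obtain k m :: "complex \<Rightarrow> int"
    where "x = (\<Sum>b\<in>B. of_int (k b) *\<^sub>R b)" "y = (\<Sum>b\<in>B. of_int (m b) *\<^sub>R b)"
    using assms(2,3) unfolding L by blast
  then have "x - y = (\<Sum>b\<in>B. of_int (k b - m b) *\<^sub>R b)"
    by (simp add: sum_subtractf scaleR_left_diff_distrib)
  then show ?thesis unfolding L by (intro CollectI exI[of _ "\<lambda>b. k b - m b"] conjI TrueI)
qed

lemma no_four_unit_vectors: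
  fixes a b c d :: complex
  assumes n: "a \<bullet> a = 1" "b \<bullet> b = 1" "c \<bullet> c = 1" "d \<bullet> d = 1"
    and i: "\<bar>a \<bullet> b\<bar> \<le> 1/2" "\<bar>a \<bullet> c\<bar> \<le> 1/2" "\<bar>a \<bullet> d\<bar> \<le> 1/2"
      "\<bar>b \<bullet> c\<bar> \<le> 1/2" "\<bar>b \<bullet> d\<bar> \<le> 1/2" "\<bar>c \<bullet> d\<bar> \<le> 1/2"
  shows False
proof -
  have sq: "t\<^sup>2 \<le> 1/4" if "\<bar>t\<bar> \<le> 1/2" for t :: real
    using power_mono[OF that, of 2] by (simp add: power2_eq_square)
  define X where "X = (Re a)\<^sup>2 + (Re b)\<^sup>2 + (Re c)\<^sup>2 + (Re d)\<^sup>2"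
  define Y where "Y = (Im a)\<^sup>2 + (Im b)\<^sup>2 + (Im c)\<^sup>2 + (Im d)\<^sup>2"
  define Z where "Z = Re a * Im a + Re b * Im b + Re c * Im c + Re d * Im d"
  have XY: "X + Y = 4"
    using n unfolding X_def Y_def inner_complex_def power2_eq_square by linarith
  have "X\<^sup>2 + 2 * Z\<^sup>2 + Y\<^sup>2 =
      (a \<bullet> a)\<^sup>2 + (b \<bullet> b)\<^sup>2 + (c \<bullet> c)\<^sup>2 + (d \<bullet> d)\<^sup>2 +
      2 * ((a \<bullet> b)\<^sup>2 + (a \<bullet> c)\<^sup>2 + (a \<bullet> d)\<^sup>2 + (b \<bullet> c)\<^sup>2 + (b \<bullet> d)\<^sup>2 + (c \<bullet> d)\<^sup>2)"
    unfolding X_def Y_def Z_def inner_complex_def by algebra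
  also have "\<dots> \<le> 7"
    using sq[OF i(1)] sq[OF i(2)] sq[OF i(3)] sq[OF i(4)] sq[OF i(5)] sq[OF i(6)] n by simp
  finally have le: "X\<^sup>2 + 2 * Z\<^sup>2 + Y\<^sup>2 \<le> 7" .
  have "2 * (X\<^sup>2 + Y\<^sup>2) = (X + Y)\<^sup>2 + (X - Y)\<^sup>2" by (simp add: power2_eq_square algebra_simps)
  also have "\<dots> \<ge> 16" unfolding XY by simp
  finally have ge: "X\<^sup>2 + Y\<^sup>2 \<ge> 8" by simp
  have "False" if "p + 2 * r + q \<le> 7" "p + q \<ge> 8" "r \<ge> 0" for p q r :: real
    using that by linarith
  from this[OF le ge zero_le_power2] show False .
qed

lemma no_3_and_1_form_beta_1:
  assumes "s_and_s'_form 3 1 l L M"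
  shows "(temperament l L M)\<^sup>2 \<noteq> 1"
proof
  assume t: "(temperament l L M)\<^sup>2 = 1"
  obtain c S S' u where w: "tempered_perfect_witness l L M c S S' u"
    and p: "consists_of_pairs 3 S" "consists_of_pairs 1 S'"
    using assms unfolding s_and_s'_form_def by blast
  define L' where "L' = (*\<^sub>R) c ` L"
  define M' where "M' = (*\<^sub>R) c ` M"
  note D = tempered_perfect_witnessD[OF w, folded L'_def M'_def]
  have "u \<ge> 1" by (fact D(4))
  then have u: "u = 1" using t temperament_eq[OF w] by simp
  have diff: "x - y \<in> L'" if "x \<in> L'" "y \<in> L'" for x y
    using that lattice_diff[OF D(2)] unfolding L'_def by (auto simp flip: scaleR_diff_right)
  have min: "v \<bullet> v \<ge> 1" if "v \<in> L'" "v \<noteq> 0" for v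
    using that D(11,12) u by (cases "v \<in> M'") auto
  have ip: "\<bar>x \<bullet> y\<bar> \<le> 1/2"
    if "x \<in> L'" "y \<in> L'" "- y \<in> L'" "x \<noteq> y" "x \<noteq> - y" "x \<bullet> x = 1" "y \<bullet> y = 1" for x y
  proof -
    have "(x - y) \<bullet> (x - y) \<ge> 1" using min[OF diff[OF that(1,2)]] that by simp
    moreover have "(x - - y) \<bullet> (x - - y) \<ge> 1"
      using min[OF diff[OF that(1,3)]] that by (simp add: add_eq_0_iff2)
    ultimately show ?thesis
      using that(6,7) by (simp add: inner_diff_left inner_diff_right inner_add_left inner_add_right inner_commute)
  qed
  obtain P where P: "card P = 3" "S = P \<union> uminus ` P" "P \<inter> uminus ` P = {}"
    using p(1) unfolding consists_of_pairs_def by blast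
  obtain a b e where abe: "P = {a, b, e}" "a \<noteq> b" "a \<noteq> e" "b \<noteq> e"
    using P(1) unfolding card_3_iff by (elim exE conjE)
  obtain P' where P': "card P' = 1" "S' = P' \<union> uminus ` P'"
    using p(2) unfolding consists_of_pairs_def by blast
  obtain d where d: "P' = {d}" using P'(1) by (auto simp: card_1_singleton_iff)
  have inL: "a \<in> L'" "- a \<in> L'" "b \<in> L'" "- b \<in> L'" "e \<in> L'" "- e \<in> L'" "d \<in> L'" "- d \<in> L'"
    using D(3,5,6) unfolding P(2) P'(2) abe d by auto
  have nM: "a \<noteq> d" "a \<noteq> - d" "b \<noteq> d" "b \<noteq> - d" "e \<noteq> d" "e \<noteq> - d"
    using D(5,6) unfolding P(2) P'(2) abe d by auto
  have ne: "a \<noteq> - b" "a \<noteq> - e" "b \<noteq> - e"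
    using P(3) unfolding abe by auto
  have un: "a \<bullet> a = 1" "b \<bullet> b = 1" "e \<bullet> e = 1" "d \<bullet> d = 1"
    using D(9,10) u unfolding P(2) P'(2) abe d by auto
  show False
    by (rule no_four_unit_vectors[OF un
          ip[OF inL(1,3,4) abe(2) ne(1) un(1,2)] ip[OF inL(1,5,6) abe(3) ne(2) un(1,3)]
          ip[OF inL(1,7,8) nM(1,2) un(1,4)] ip[OF inL(3,5,6) abe(4) ne(3) un(2,3)]
          ip[OF inL(3,7,8) nM(3,4) un(2,4)] ip[OF inL(5,7,8) nM(5,6) un(3,4)]])
qed

end

theory Submission
  imports Defs
begin

text \<open>
  Take \<open>L = \<int>[\<omega>]\<close>, let \<open>v = a + b\<omega>\<close> be the given primitive element of norm \<open>\<beta>\<close>, complete it to a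
  basis \<open>v, w\<close> of \<open>L\<close>, and put \<open>M = \<int>v + l\<int>w\<close>. An element of \<open>M\<close> off the line \<open>\<int>v\<close> has squared
  distance at least \<open>3l\<^sup>2/(4\<beta>) > \<beta>\<close> from that line, so \<open>\<plusminus>v\<close> are the only shortest vectors of \<open>M\<close>.
  As \<open>\<beta> > 1\<close>, the six units lie outside \<open>M\<close>, and the value \<open>1\<close> on them determines the form.
\<close>

section \<open>Lattices with an explicit two-vector basis\<close>

definition int_span2 :: "complex \<Rightarrow> complex \<Rightarrow> complex set" where
  "int_span2 x y = {of_int m *\<^sub>R x + of_int n *\<^sub>R y | m n :: int. True}"

text \<open>A nonzero determinant gives independence by Cramer's rule, and two independent vectors
  span the plane by dimension. It also forces \<open>x \<noteq> y\<close>, so that a pair of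
  coefficients is the same thing as a function on the set \<open>{x, y}\<close>.\<close>

lemma is_lattice_int_span2:
  assumes "Re x * Im y - Im x * Re y \<noteq> 0"
  shows "is_lattice (int_span2 x y)"
proof -
  have ne: "x \<noteq> y" using assms by auto
  have ind: "independent {x, y}"
  proof (rule independent_if_scalars_zero)
    fix f :: "complex \<Rightarrow> real" and z
    assume s: "(\<Sum>b\<in>{x, y}. f b *\<^sub>R b) = 0" and z: "z \<in> {x, y}"
    have e: "f x * Re x + f y * Re y = 0" "f x * Im x + f y * Im y = 0"
      using s ne by (simp_all add: complex_eq_iff)
    have "f x * (Re x * Im y - Im x * Re y) = 0" "f y * (Re x * Im y - Im x * Re y) = 0"
      using e by algebra+
    then show "f z = 0" using assms z by auto
  qed simp
  have "dim (span {x, y}) = 2" using ind ne by (simp add: dim_eq_card_independent)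
  then have sp: "span {x, y} = UNIV"
    using dim_eq_full[of "{x, y}"] by simp
  have "int_span2 x y = {\<Sum>b\<in>{x, y}. of_int (k b) *\<^sub>R b | k :: complex \<Rightarrow> int. True}"
    (is "_ = ?R")
  proof
    show "?R \<subseteq> int_span2 x y" using ne by (auto simp: int_span2_def)
    show "int_span2 x y \<subseteq> ?R"
    proof
      fix z assume "z \<in> int_span2 x y"
      then obtain m n where "z = of_int m *\<^sub>R x + of_int n *\<^sub>R y"
        by (auto simp: int_span2_def)
      then have "z = (\<Sum>b\<in>{x, y}. of_int (if b = x then m else n) *\<^sub>R b)" using ne by simp
      then show "z \<in> ?R" by (intro CollectI exI[of _ "\<lambda>b. if b = x then m else n"] conjI TrueI)
    qed
  qed
  with ind sp show ?thesis unfolding is_lattice_def by blast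
qed

section \<open>Eisenstein integers x + y\<omega>, their norm and their units\<close>

definition eis :: "int \<Rightarrow> int \<Rightarrow> complex" where
  "eis x y = Complex (of_int x - of_int y / 2) (of_int y * sqrt 3 / 2)"

definition eis_norm :: "int \<Rightarrow> int \<Rightarrow> int" where
  "eis_norm x y = x\<^sup>2 - x * y + y\<^sup>2"

lemma eis_eq_iff [simp]: "eis x y = eis x' y' \<longleftrightarrow> x = x' \<and> y = y'"
  by (auto simp: eis_def)

lemma eis_eq_0_iff [simp]: "eis x y = 0 \<longleftrightarrow> x = 0 \<and> y = 0"
  by (auto simp: eis_def complex_eq_iff)

lemma uminus_eis [simp]: "- eis x y = eis (- x) (- y)"
  by (simp add: eis_def complex_eq_iff)

lemma eis_comb:
  "of_int m *\<^sub>R eis x y + of_int n *\<^sub>R eis x' y' = eis (m * x + n * x') (m * y + n * y')"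
  by (simp add: eis_def complex_eq_iff algebra_simps add_divide_distrib)

lemma eis_add: "eis x y + eis x' y' = eis (x + x') (y + y')"
  using eis_comb[of 1 x y 1 x' y'] by simp

lemma std_form_eis: "std_form (eis x y) = of_int (eis_norm x y)"
proof -
  have "(sqrt 3)\<^sup>2 = 3" by simp
  then have "(of_int x - of_int y / 2) * (of_int x - of_int y / 2) +
      (of_int y * sqrt 3 / 2) * (of_int y * sqrt 3 / 2) =
      (of_int x)\<^sup>2 - of_int x * of_int y + (of_int y)\<^sup>2"
    by (simp add: power2_eq_square field_simps)
  then show ?thesis by (simp add: std_form_def eis_def eis_norm_def inner_complex_def)
qed

text \<open>Twice the norm is the sum of the squares of x - y, x and y.\<close>

lemma eis_norm_pos:
  assumes "x \<noteq> 0 \<or> y \<noteq> 0"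
  shows "eis_norm x y > 0"
proof -
  have e: "2 * eis_norm x y = (x - y)\<^sup>2 + x\<^sup>2 + y\<^sup>2"
    by (simp add: eis_norm_def power2_eq_square algebra_simps)
  have "x\<^sup>2 + y\<^sup>2 > 0" using assms by (simp add: sum_power2_gt_zero_iff)
  then show ?thesis using e zero_le_power2[of "x - y"] by linarith
qed

text \<open>Completing the square in either variable bounds the square of the other by 4/3, so both
  coordinates lie in {-1, 0, 1} and a finite check remains.\<close>

lemma eis_norm_eq_1:
  assumes "eis_norm x y = 1"
  shows "(x, y) \<in> {(1, 0), (0, 1), (1, 1), (-1, 0), (0, -1), (-1, -1)}"
proof -
  have "4 * eis_norm x y = (2 * x - y)\<^sup>2 + 3 * y\<^sup>2" "4 * eis_norm x y = (2 * y - x)\<^sup>2 + 3 * x\<^sup>2"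
    by (simp_all add: eis_norm_def power2_eq_square algebra_simps)
  then have "y\<^sup>2 < 4" "x\<^sup>2 < 4"
    using assms zero_le_power2[of "2 * x - y"] zero_le_power2[of "2 * y - x"] by linarith+
  then have "y\<^sup>2 < 2\<^sup>2" "x\<^sup>2 < 2\<^sup>2" by simp_all
  then have "\<bar>y\<bar> < 2" "\<bar>x\<bar> < 2" using abs_square_less_1 power2_less_imp_less
    by (metis abs_of_nonneg power2_abs zero_le_numeral)+
  then have "x \<in> {-1, 0, 1}" "y \<in> {-1, 0, 1}" by auto
  then show ?thesis using assms by (auto simp: eis_norm_def)
qed

text \<open>Written as P together with -P, where P consists of 1, \<omega> and 1 + \<omega>, so that
  the three pairs can be read off.\<close>

definition eis_units :: "complex set" where
  "eis_units = {eis 1 0, eis 0 1, eis 1 1} \<union> uminus ` {eis 1 0, eis 0 1, eis 1 1}"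

lemma eis_norm_eq_1_iff: "eis_norm x y = 1 \<longleftrightarrow> eis x y \<in> eis_units"
  using eis_norm_eq_1[of x y] by (auto simp: eis_units_def eis_norm_def)

lemma consists_of_pairs_eis_units: "consists_of_pairs 3 eis_units"
  unfolding consists_of_pairs_def eis_units_def
  by (rule exI[of _ "{eis 1 0, eis 0 1, eis 1 1}"]) auto

text \<open>A binary quadratic form has three coefficients, and its values at 1, \<omega> and 1 +
  \<omega> fix all three. This is the perfection of the hexagonal lattice.\<close>

lemma quadratic_form_determined_by_eis_units:
  assumes "pos_def_quadratic_form Q" and one: "\<And>z. z \<in> eis_units \<Longrightarrow> Q z = 1"
  shows "Q = std_form"
proof -
  obtain b where bl: "bilinear b" and sym: "\<And>x y. b x y = b y x" and Q: "\<And>z. Q z = b z z"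
    using assms(1) unfolding pos_def_quadratic_form_def by blast
  define e f where "e = eis 1 0" and "f = eis 0 1"
  note simps = bilinear_ladd[OF bl] bilinear_radd[OF bl] bilinear_lmul[OF bl] bilinear_rmul[OF bl]
  have ef: "e + f = eis 1 1" by (simp add: e_def f_def eis_add)
  have "Q e = 1" "Q f = 1" "Q (e + f) = 1"
    unfolding ef by (auto intro!: one simp: eis_units_def e_def f_def)
  \<comment> \<open>Polarization: 1 = \<open>Q (e + f)\<close> = 1 + 1 + 2
    \<open>b e f\<close>.\<close>
  then have b: "b e e = 1" "b f f = 1" "b e f = - 1 / 2" "b f e = - 1 / 2"
    using sym[of f e] by (simp_all add: Q simps)
  have "Q z = std_form z" for z
  proof -
    \<comment> \<open>The real coordinates of \<open>z\<close> in the basis 1, \<omega>.\<close>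
    define t where "t = 2 * Im z / sqrt 3"
    define s where "s = Re z + t / 2"
    have z: "z = s *\<^sub>R e + t *\<^sub>R f"
      by (simp add: complex_eq_iff e_def f_def eis_def s_def t_def)
    have "Q z = s\<^sup>2 - s * t + t\<^sup>2"
      unfolding Q z simps using b by (simp add: power2_eq_square algebra_simps)
    moreover have "std_form z = (s - t / 2)\<^sup>2 + 3 * (t / 2)\<^sup>2"
      by (simp add: std_form_def inner_complex_def s_def t_def power2_eq_square)
    ultimately show ?thesis by (simp add: power2_eq_square algebra_simps)
  qed
  then show ?thesis by blast
qed

text \<open>Adding multiples of \<open>v\<close> or of l times \<open>w\<close> does not change a
  coset, so the coset of mv + nw depends only on n mod l, and the l residues give distinct
  cosets.\<close>

lemma lattice_index_int_span2:
  assumes "l > 0" and det: "Re v * Im w - Im v * Re w \<noteq> 0"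
  shows "lattice_index (int_span2 v w) (int_span2 v (of_nat l *\<^sub>R w)) = l"
proof -
  define M where "M = int_span2 v (of_nat l *\<^sub>R w)"
  define C where "C = (\<lambda>k :: int. (+) (of_int k *\<^sub>R w) ` M)"
  have coords: "m = m' \<and> n = n'"
    if "of_int m *\<^sub>R v + of_int n *\<^sub>R w = of_int m' *\<^sub>R v + of_int n' *\<^sub>R w"
    for m n m' n' :: int
  proof -
    have e: "(of_int m - of_int m') * Re v + (of_int n - of_int n') * Re w = 0"
      "(of_int m - of_int m') * Im v + (of_int n - of_int n') * Im w = 0"
      using that by (simp_all add: complex_eq_iff algebra_simps)
    have "(of_int m - of_int m') * (Re v * Im w - Im v * Re w) = 0"
      "(of_int n - of_int n') * (Re v * Im w - Im v * Re w) = 0"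
      using e by algebra+
    then show ?thesis using det by simp
  qed
  have M: "z \<in> M \<longleftrightarrow> (\<exists>m n :: int. z = of_int m *\<^sub>R v + of_int (n * int l) *\<^sub>R w)" for z
    by (simp add: M_def int_span2_def)
  have shift: "(+) (of_int m *\<^sub>R v + of_int n *\<^sub>R w) ` M = C (n mod int l)" for m n :: int
  proof -
    define r d where "r = n mod int l" and "d = n div int l"
    have n: "n = r + d * int l" by (simp add: r_def d_def)
    have 1: "of_int m *\<^sub>R v + of_int n *\<^sub>R w + (of_int i *\<^sub>R v + of_int (j * int l) *\<^sub>R w) =
        of_int r *\<^sub>R w + (of_int (i + m) *\<^sub>R v + of_int ((j + d) * int l) *\<^sub>R w)" for i j :: int
      unfolding n by (simp add: algebra_simps)
    have 2: "of_int r *\<^sub>R w + (of_int i *\<^sub>R v + of_int (j * int l) *\<^sub>R w) =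
        of_int m *\<^sub>R v + of_int n *\<^sub>R w +
          (of_int (i - m) *\<^sub>R v + of_int ((j - d) * int l) *\<^sub>R w)" for i j :: int
      unfolding n by (simp add: algebra_simps)
    show ?thesis unfolding C_def image_def Bex_def M r_def[symmetric] using 1 2 by blast
  qed
  have "(\<lambda>z. (+) z ` M) ` int_span2 v w = C ` {0..<int l}"
  proof
    show "(\<lambda>z. (+) z ` M) ` int_span2 v w \<subseteq> C ` {0..<int l}"
      using assms(1) by (auto simp: int_span2_def shift)
    show "C ` {0..<int l} \<subseteq> (\<lambda>z. (+) z ` M) ` int_span2 v w"
    proof
      fix X assume "X \<in> C ` {0..<int l}"
      then obtain k where "X = (+) (of_int 0 *\<^sub>R v + of_int k *\<^sub>R w) ` M" by (auto simp: C_def)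
      then show "X \<in> (\<lambda>z. (+) z ` M) ` int_span2 v w" unfolding int_span2_def by blast
    qed
  qed
  moreover have "inj_on C {0..<int l}"
  proof (rule inj_onI)
    fix j k assume jk: "j \<in> {0..<int l}" "k \<in> {0..<int l}" and eq: "C j = C k"
    \<comment> \<open>As 0 lies in \<open>M\<close>, the vector jw lies in its own coset. Locating
      it in \<open>C k\<close> and comparing coefficients of \<open>w\<close> gives j and k
      congruent mod l.\<close>
    have "0 \<in> M" unfolding M by (intro exI[of _ 0]) simp
    then have "of_int j *\<^sub>R w \<in> C j" unfolding C_def by force
    then have "of_int j *\<^sub>R w \<in> C k" by (simp only: eq)
    then obtain z where z: "of_int j *\<^sub>R w = of_int k *\<^sub>R w + z" and "z \<in> M"
      unfolding C_def by (rule imageE)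
    then obtain m n where "z = of_int m *\<^sub>R v + of_int (n * int l) *\<^sub>R w"
      unfolding M by (elim exE)
    with z have "of_int 0 *\<^sub>R v + of_int j *\<^sub>R w = of_int m *\<^sub>R v + of_int (k + n * int l) *\<^sub>R w"
      by (simp add: algebra_simps)
    then have "j = k + n * int l" using coords by blast
    then have "j mod int l = k mod int l" by simp
    then show "j = k" using jk by simp
  qed
  ultimately show ?thesis
    unfolding lattice_index_def M_def[symmetric] by (simp add: card_image)
qed

theorem theorem1:
  fixes l :: nat and \<beta> :: int
  assumes "prime l"
    and "real_of_int \<beta> < sqrt 3 / 2 * real l"
    and "\<exists>a b :: int. gcd a b = 1 \<and> \<beta> = a\<^sup>2 - a * b + b\<^sup>2"
    and "\<beta> \<noteq> 1"
  shows "\<exists>L M. s_and_s'_form 3 1 l L M \<and> (temperament l L M)\<^sup>2 = real_of_int \<beta>"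
proof -
  obtain a b where g: "gcd a b = 1" and "\<beta> = a\<^sup>2 - a * b + b\<^sup>2"
    using assms(3) by (elim exE conjE)
  then have \<beta>: "\<beta> = eis_norm a b" by (simp add: eis_norm_def)
  \<comment> \<open>Bezout yields the second basis vector: q = s and p = -t make the determinant of
    (a, b), (p, q) equal to 1.\<close>
  obtain s t where "s * a + t * b = 1" using bezout_int[of a b] g by auto
  then obtain p q where pq: "a * q - b * p = 1"
    by (metis add.inverse_inverse diff_minus_eq_add mult.commute mult_minus_right)
  have l: "l > 0" using assms(1) by (simp add: prime_gt_0_nat)
  have v0: "a \<noteq> 0 \<or> b \<noteq> 0" using g by auto
  have \<beta>1: "\<beta> > 1" using eis_norm_pos[OF v0] \<beta> assms(4) by simp
  \<comment> \<open>Squaring removes the irrational bound, so the later comparison of norms stays in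
    the integers.\<close>
  have \<beta>l: "4 * \<beta>\<^sup>2 < 3 * (int l)\<^sup>2"
  proof -
    have "(real_of_int \<beta>)\<^sup>2 < (sqrt 3 / 2 * real l)\<^sup>2"
      using assms(2) \<beta>1 by (intro power_strict_mono) auto
    then have "real_of_int (4 * \<beta>\<^sup>2) < real_of_int (3 * (int l)\<^sup>2)"
      by (simp add: power_mult_distrib power_divide)
    then show ?thesis by (simp only: of_int_less_iff)
  qed

  \<comment> \<open>The two lattices in Eisenstein coordinates\<close>
  define v w where "v = eis a b" and "w = eis p q"
  define L where "L = int_span2 v w"
  define M where "M = int_span2 v (of_nat l *\<^sub>R w)"
  have "Re v * Im w - Im v * Re w = sqrt 3 / 2 * of_int (a * q - b * p)"
    by (simp add: v_def w_def eis_def field_simps)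
  also have "\<dots> \<noteq> 0" using pq by simp
  finally have det: "Re v * Im w - Im v * Re w \<noteq> 0" .
  then have det': "Re v * Im (of_nat l *\<^sub>R w) - Im v * Re (of_nat l *\<^sub>R w) \<noteq> 0"
    using l by (simp add: algebra_simps)
  have L: "L = {eis x y | x y. True}"
  proof
    show "L \<subseteq> {eis x y | x y. True}" by (auto simp: L_def int_span2_def v_def w_def eis_comb)
    show "{eis x y | x y. True} \<subseteq> L"
    proof clarify
      fix x y
      \<comment> \<open>The coefficients come from inverting the basis matrix; they are integers
        because its determinant is 1.\<close>
      have "(x * q - y * p) * a + (a * y - b * x) * p = x * (a * q - b * p)"
        "(x * q - y * p) * b + (a * y - b * x) * q = y * (a * q - b * p)"
        by (simp_all add: algebra_simps)
      then have "eis x y = of_int (x * q - y * p) *\<^sub>R v + of_int (a * y - b * x) *\<^sub>R w"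
        unfolding v_def w_def eis_comb pq by simp
      then show "eis x y \<in> L" unfolding L_def int_span2_def by blast
    qed
  qed
  have M: "z \<in> M \<longleftrightarrow> (\<exists>m n. z = eis (m * a + n * int l * p) (m * b + n * int l * q))" for z
  proof -
    have "of_int m *\<^sub>R v + of_int n *\<^sub>R of_nat l *\<^sub>R w =
        eis (m * a + n * int l * p) (m * b + n * int l * q)" for m n
      using eis_comb[of m a b "n * int l" p q] by (simp add: v_def w_def)
    then show ?thesis unfolding M_def int_span2_def by simp
  qed
  have sub: "M \<subseteq> L" using M unfolding L by blast

  \<comment> \<open>The shortest vectors of \<open>M\<close>\<close>
  have minM: "eis_norm x y > \<beta>"
    if inM: "eis x y \<in> M" and "eis x y \<noteq> 0" "eis x y \<notin> {v, - v}" for x y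
  proof -
    obtain m n where mn: "x = m * a + n * int l * p" "y = m * b + n * int l * q"
      using inM unfolding M eis_eq_iff by (elim exE conjE)
    show ?thesis
    proof (cases "n = 0")
      \<comment> \<open>On the line through \<open>v\<close> only multiples mv with |m| > 1 remain,
        of norm at least 4\<beta>.\<close>
      case True
      then have "eis_norm x y = m\<^sup>2 * \<beta>"
        unfolding mn \<beta> eis_norm_def by (simp add: power2_eq_square algebra_simps)
      moreover have "m \<noteq> 0" "m \<noteq> 1" "m \<noteq> -1" using that True unfolding mn v_def by auto
      then have "\<bar>m\<bar> > 1" by linarith
      then have "m\<^sup>2 > 1" using power_strict_mono[of 1 "\<bar>m\<bar>" 2] by simp
      ultimately show ?thesis using \<beta>1 by simp
    next
      case False
      \<comment> \<open>The determinant of \<open>v\<close> with a vector of \<open>M\<close> is a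
        multiple of l, here a nonzero one.\<close>
      have "a * y - b * x = n * int l * (a * q - b * p)" unfolding mn by (simp add: algebra_simps)
      then have d: "a * y - b * x = n * int l" unfolding pq by simp
      \<comment> \<open>With z = x + y\<omega>, this is 4|v|^2|z|^2 as the sum of the squares of
        twice the real and twice the imaginary part of conj(v)z. The second square alone is at least
        3l^2, which exceeds 4\<beta>^2.\<close>
      have "4 * \<beta> * eis_norm x y = (2 * a * x - a * y - b * x + 2 * b * y)\<^sup>2 + 3 * (a * y - b * x)\<^sup>2"
        unfolding \<beta> eis_norm_def by (simp add: power2_eq_square algebra_simps)
      then have "4 * \<beta> * eis_norm x y \<ge> 3 * (n\<^sup>2 * (int l)\<^sup>2)"
        unfolding d power_mult_distrib using zero_le_power2 by simp
      moreover have "n\<^sup>2 \<ge> 1" using False by (simp add: int_one_le_iff_zero_less)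
      then have "n\<^sup>2 * (int l)\<^sup>2 \<ge> 1 * (int l)\<^sup>2" by (intro mult_right_mono) auto
      ultimately have "\<beta> * eis_norm x y > \<beta> * \<beta>"
        using \<beta>l unfolding power2_eq_square by linarith
      then show ?thesis using \<beta>1 by simp
    qed
  qed
  have vM: "v \<in> M" "- v \<in> M"
    unfolding M v_def by (intro exI[of _ 1] exI[of _ 0], simp, intro exI[of _ "-1"] exI[of _ 0], simp)
  have Qv: "std_form v = \<beta>" "std_form (- v) = \<beta>"
    by (simp_all add: v_def std_form_eis \<beta> eis_norm_def)
  \<comment> \<open>A unit has norm 1 < \<beta>, whereas every nonzero vector of \<open>M\<close>
    has norm at least \<beta>.\<close>
  have UL: "eis_units \<subseteq> L - M"
  proof
    fix z assume z: "z \<in> eis_units"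
    then obtain x y where xy: "z = eis x y" unfolding eis_units_def by auto
    then have n1: "eis_norm x y = 1" using z eis_norm_eq_1_iff by simp
    then have "z \<noteq> 0" unfolding xy by (auto simp: eis_norm_def)
    moreover have "z \<notin> {v, - v}" using Qv \<beta>1 n1 std_form_eis[of x y] unfolding xy by auto
    ultimately have "z \<notin> M" using minM[of x y] n1 \<beta>1 unfolding xy by auto
    then show "z \<in> L - M" unfolding L xy by blast
  qed
  have tm: "tempered_min std_form \<beta> L M eis_units {v, - v}"
    unfolding tempered_min_def
  proof (intro conjI ballI impI)
    fix z assume "z \<in> eis_units"
    moreover from this obtain x y where "z = eis x y" unfolding eis_units_def by auto
    ultimately show "std_form z = 1" using eis_norm_eq_1_iff std_form_eis by simp
  next
    fix z assume z: "z \<in> L - M" "z \<notin> eis_units"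
    then obtain x y where xy: "z = eis x y" unfolding L by blast
    \<comment> \<open>Since 0 is in \<open>M\<close>, a vector outside \<open>M\<close> is nonzero,
      so its norm is a positive integer, equal to 1 only at the units.\<close>
    have "0 \<in> M" unfolding M by (intro exI[of _ 0]) (simp add: eq_commute[of 0])
    then have "z \<noteq> 0" using z(1) by (metis DiffD2)
    then have "x \<noteq> 0 \<or> y \<noteq> 0" unfolding xy by simp
    then have "eis_norm x y > 1" using eis_norm_pos[of x y] z(2) eis_norm_eq_1_iff[of x y]
      unfolding xy by force
    then show "std_form z > 1" unfolding xy std_form_eis by simp
  next
    fix z assume z: "z \<in> M - {0}" "z \<notin> {v, - v}"
    then obtain x y where xy: "z = eis x y" using sub unfolding L by blast
    show "std_form z > \<beta>" using minM[of x y] z unfolding xy std_form_eis by simp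
  qed (use Qv \<beta>1 in auto)

  \<comment> \<open>Perfection and temperament of the pair\<close>
  have "normalized_tempered_perfect L M eis_units {v, - v} \<beta>"
    unfolding normalized_tempered_perfect_def
  proof (intro conjI allI impI UL tm)
    show "eis_units \<noteq> {}" by (simp add: eis_units_def)
    show "{v, - v} \<subseteq> M - {0}" using vM v0 by (simp add: v_def)
  next
    fix B u' assume B: "pos_def_quadratic_form B" "tempered_min B u' L M eis_units {v, - v}"
    then show *: "B = std_form"
      by (intro quadratic_form_determined_by_eis_units) (simp_all add: tempered_min_def)
    \<comment> \<open>Once the form is the standard one, its common value is read off at
      \<open>v\<close>.\<close>
    show "u' = \<beta>" using B(2) Qv unfolding * tempered_min_def by simp
  qed simp
  \<comment> \<open>No rescaling is required, the units having length 1 already.\<close>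
  moreover have "(*\<^sub>R) 1 ` X = X" for X :: "complex set" by simp
  ultimately have wit: "tempered_perfect_witness l L M 1 eis_units {v, - v} \<beta>"
    unfolding tempered_perfect_witness_def
    using assms(1) sub is_lattice_int_span2[OF det] is_lattice_int_span2[OF det']
      lattice_index_int_span2[OF l det]
    by (simp add: L_def M_def)
  have "consists_of_pairs 1 {v, - v}"
    unfolding consists_of_pairs_def by (rule exI[of _ "{v}"]) (use v0 in \<open>auto simp: v_def\<close>)
  then have "s_and_s'_form 3 1 l L M"
    unfolding s_and_s'_form_def using wit consists_of_pairs_eis_units by blast
  moreover have "(temperament l L M)\<^sup>2 = \<beta>"
    using temperament_eq[OF wit] \<beta>1 by simp
  ultimately show ?thesis by blast
qed

end
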